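(* Let ${}^{*}X$ be a directed functional extension of $X$. Then there is a unique way of assigning to every $n$-ary function $\varphi:X^n\to X$ ($n\ge1$) an extension ${}^{*}\varphi:({}^{*}X)^n\to{}^{*}X$, agreeing with the given ${}^{*}f$ for unary $f$, so as to preserve all compositions (i.e. ${}^{*}\varphi\circ({}^{*}\psi_1,\dots,{}^{*}\psi_n)={}^{*}(\varphi\circ(\psi_1,\dots,\psi_n))$ for all $m,n\ge1$, $\varphi:X^n\to X$ and $\psi_1,\dots,\psi_n:X^m\to X$). It is given by $${}^{*}\varphi(\xi_1,\dots,\xi_n)={}^{*}(\varphi\circ(f_1,\dots,f_n))(\zeta),$$ where $f_1,\dots,f_n:X\to X$ and $\zeta\in{}^{*}X$ are any functions and point with ${}^{*}f_i(\zeta)=\xi_i$ for $i=1,\dots,n$ (such exist, and the value does not depend on their choice).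
   Context: $X$ is a set with distinct elements $0,1\in X$. A functional extension of $X$ is a superset ${}^{*}X\supseteq X$ with an assignment to each $f:X\to X$ of ${}^{*}f:{}^{*}X\to{}^{*}X$ extending $f$ such that for all $f,g:X\to X$, $\xi\in{}^{*}X$: (comp) ${}^{*}g({}^{*}f(\xi))={}^{*}(g\circ f)(\xi)$; (diag) ${}^{*}(\chi\circ(f,g))(\xi)=1$ if ${}^{*}f(\xi)={}^{*}g(\xi)$ and $0$ otherwise, where $\chi:X\times X\to\{0,1\}$ is the characteristic function of the diagonal and $\chi\circ(f,g)$ is $x\mapsto\chi(f(x),g(x))$. It is directed if for all $\xi,\eta\in{}^{*}X$ there exist $f,g:X\to X$ and $\zeta\in{}^{*}X$ with ${}^{*}f(\zeta)=\xi$, ${}^{*}g(\zeta)=\eta$. For $\varphi:X^n\to X$ and $f_1,\dots,f_n:X\to X$, $\varphi\circ(f_1,\dots,f_n):X\to X$ denotes $x\mapsto\varphi(f_1(x),\dots,f_n(x))$. *)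

theory Defs
  imports Main "HOL-Library.FuncSet"
begin

text \<open>
  Functions between sets are rendered as the extensional functions \<open>A \<rightarrow>\<^sub>E B\<close>, so that equality of
  the HOL functions is equality of functions between the sets. The \<open>n\<close>-tuples over \<open>A\<close> are indexed
  by \<open>0, \<dots>, n - 1\<close>.
\<close>

definition tuples :: "nat \<Rightarrow> 'a set \<Rightarrow> (nat \<Rightarrow> 'a) set" where
  "tuples n A = ({..<n} \<rightarrow>\<^sub>E A)"

definition nary :: "nat \<Rightarrow> 'a set \<Rightarrow> ((nat \<Rightarrow> 'a) \<Rightarrow> 'a) set" where
  "nary n A = (tuples n A \<rightarrow>\<^sub>E A)"

text \<open>
  The composition \<open>\<phi> \<circ> (\<psi>\<^sub>0, \<dots>, \<psi>\<^sub>n\<^sub>-\<^sub>1)\<close>, where all \<open>\<psi>\<^sub>i\<close> have domain \<open>D\<close>; \<open>D\<close> is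
  a set of tuples or the base set itself.
\<close>

definition tuple_comp ::
  "'d set \<Rightarrow> nat \<Rightarrow> ((nat \<Rightarrow> 'a) \<Rightarrow> 'a) \<Rightarrow> (nat \<Rightarrow> 'd \<Rightarrow> 'a) \<Rightarrow> 'd \<Rightarrow> 'a" where
  "tuple_comp D n \<phi> \<psi> = (\<lambda>x\<in>D. \<phi> (\<lambda>i\<in>{..<n}. \<psi> i x))"

definition as_unary :: "'a set \<Rightarrow> ('a \<Rightarrow> 'a) \<Rightarrow> (nat \<Rightarrow> 'a) \<Rightarrow> 'a" where
  "as_unary A f = (\<lambda>x\<in>tuples 1 A. f (x 0))"

definition diag_char :: "'a \<Rightarrow> 'a \<Rightarrow> 'a \<Rightarrow> 'a \<Rightarrow> 'a" where
  "diag_char e0 e1 x y = (if x = y then e1 else e0)"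

locale functional_extension =
  fixes X :: "'a set" and Y :: "'a set" and e0 e1 :: 'a
    and star :: "('a \<Rightarrow> 'a) \<Rightarrow> 'a \<Rightarrow> 'a"
  assumes e0_in: "e0 \<in> X"
    and e1_in: "e1 \<in> X"
    and e0_neq_e1: "e0 \<noteq> e1"
    and subset: "X \<subseteq> Y"
    and star_in: "f \<in> X \<rightarrow>\<^sub>E X \<Longrightarrow> star f \<in> Y \<rightarrow>\<^sub>E Y"
    and star_extends: "f \<in> X \<rightarrow>\<^sub>E X \<Longrightarrow> x \<in> X \<Longrightarrow> star f x = f x"
    and star_comp: "f \<in> X \<rightarrow>\<^sub>E X \<Longrightarrow> g \<in> X \<rightarrow>\<^sub>E X \<Longrightarrow> \<xi> \<in> Y \<Longrightarrow>
      star g (star f \<xi>) = star (compose X g f) \<xi>"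
    and star_diag: "f \<in> X \<rightarrow>\<^sub>E X \<Longrightarrow> g \<in> X \<rightarrow>\<^sub>E X \<Longrightarrow> \<xi> \<in> Y \<Longrightarrow>
      star (\<lambda>x\<in>X. diag_char e0 e1 (f x) (g x)) \<xi> = (if star f \<xi> = star g \<xi> then e1 else e0)"

locale directed_functional_extension = functional_extension +
  assumes directed: "\<xi> \<in> Y \<Longrightarrow> \<eta> \<in> Y \<Longrightarrow>
    \<exists>f\<in>X \<rightarrow>\<^sub>E X. \<exists>g\<in>X \<rightarrow>\<^sub>E X. \<exists>\<zeta>\<in>Y. star f \<zeta> = \<xi> \<and> star g \<zeta> = \<eta>"

text \<open>
  The assignment \<open>S\<close> is itself extensional (in the arity \<open>n \<ge> 1\<close> and in the \<open>n\<close>-ary function),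
  so that unique existence of \<open>S\<close> can be expressed by \<open>\<exists>!\<close>.
\<close>

definition nary_extension_assignment ::
  "'a set \<Rightarrow> 'a set \<Rightarrow> (('a \<Rightarrow> 'a) \<Rightarrow> 'a \<Rightarrow> 'a) \<Rightarrow>
    (nat \<Rightarrow> ((nat \<Rightarrow> 'a) \<Rightarrow> 'a) \<Rightarrow> (nat \<Rightarrow> 'a) \<Rightarrow> 'a) \<Rightarrow> bool" where
  "nary_extension_assignment X Y star S \<longleftrightarrow>
    S \<in> (\<Pi>\<^sub>E n\<in>{1..}. nary n X \<rightarrow>\<^sub>E nary n Y) \<and>
    (\<forall>n\<ge>1. \<forall>\<phi>\<in>nary n X. \<forall>x\<in>tuples n X. S n \<phi> x = \<phi> x) \<and>
    (\<forall>f\<in>X \<rightarrow>\<^sub>E X. S 1 (as_unary X f) = as_unary Y (star f)) \<and>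
    (\<forall>m\<ge>1. \<forall>n\<ge>1. \<forall>\<phi>\<in>nary n X. \<forall>\<psi>\<in>{..<n} \<rightarrow> nary m X.
      tuple_comp (tuples m Y) n (S n \<phi>) (\<lambda>i. S m (\<psi> i)) =
      S m (tuple_comp (tuples m X) n \<phi> \<psi>))"

definition represents ::
  "'a set \<Rightarrow> 'a set \<Rightarrow> (('a \<Rightarrow> 'a) \<Rightarrow> 'a \<Rightarrow> 'a) \<Rightarrow> nat \<Rightarrow> (nat \<Rightarrow> 'a \<Rightarrow> 'a) \<Rightarrow> 'a \<Rightarrow>
    (nat \<Rightarrow> 'a) \<Rightarrow> bool" where
  "represents X Y star n f \<zeta> \<xi> \<longleftrightarrow>
    f \<in> {..<n} \<rightarrow> (X \<rightarrow>\<^sub>E X) \<and> \<zeta> \<in> Y \<and> (\<forall>i<n. star (f i) \<zeta> = \<xi> i)"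

end

theory Submission
  imports Defs
begin

text \<open>
  The key fact is that \<open>*f\<^sub>i(\<zeta>) = *g\<^sub>i(\<zeta>)\<close> for finitely many \<open>i\<close> implies \<open>*h(\<zeta>) = *k(\<zeta>)\<close> whenever
  \<open>h\<close> and \<open>k\<close> agree at all points of \<open>X\<close> where \<open>f\<^sub>i = g\<^sub>i\<close> for all \<open>i\<close>. By directedness, any two
  representations of a tuple of \<open>*X\<close> are pulled back to a common point, where the key fact shows that
  they give the same value of \<open>*\<phi>\<close>. Preservation of compositions can then be checked on
  representatives, and conversely it forces the formula when applied to \<open>\<phi> \<circ> (f\<^sub>1, \<dots>, f\<^sub>n)\<close>.
\<close>

section \<open>Composition of finitary functions\<close>

lemma tuple_comp_in:
  assumes "\<phi> \<in> nary n A" and "\<And>i. i < n \<Longrightarrow> \<psi> i \<in> D \<rightarrow>\<^sub>E A"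
  shows "tuple_comp D n \<phi> \<psi> \<in> D \<rightarrow>\<^sub>E A"
proof -
  have "(\<lambda>i\<in>{..<n}. \<psi> i x) \<in> tuples n A" if "x \<in> D" for x
    using PiE_mem[OF assms(2) that] unfolding tuples_def by auto
  then show ?thesis
    using assms(1) unfolding tuple_comp_def nary_def by auto
qed

lemma tuple_comp_apply: "x \<in> D \<Longrightarrow> tuple_comp D n \<phi> \<psi> x = \<phi> (\<lambda>i\<in>{..<n}. \<psi> i x)"
  by (simp add: tuple_comp_def)

lemma as_unary_in: "f \<in> A \<rightarrow>\<^sub>E A \<Longrightarrow> as_unary A f \<in> nary 1 A"
  unfolding as_unary_def nary_def tuples_def by auto

lemma compose_in: "f \<in> A \<rightarrow>\<^sub>E A \<Longrightarrow> g \<in> A \<rightarrow>\<^sub>E A \<Longrightarrow> compose A g f \<in> A \<rightarrow>\<^sub>E A"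
  unfolding compose_def by auto

text \<open>With \<open>star_comp\<close>, this moves a value of the formula from
  \<open>star p \<rho>\<close> back to \<rho>.\<close>

lemma compose_tuple_comp:
  assumes "p \<in> X \<rightarrow>\<^sub>E X"
  shows "compose X (tuple_comp X n \<phi> f) p = tuple_comp X n \<phi> (\<lambda>i. compose X (f i) p)"
proof
  fix x
  show "compose X (tuple_comp X n \<phi> f) p x = tuple_comp X n \<phi> (\<lambda>i. compose X (f i) p) x"
    using assms by (cases "x \<in> X") (auto simp: compose_def tuple_comp_def PiE_def Pi_def)
qed

section \<open>Transfer of implications between equations\<close>

context functional_extension
begin

lemma diag_in:
  "(\<lambda>x\<in>X. diag_char e0 e1 (f x) (g x)) \<in> X \<rightarrow>\<^sub>E X"
  using e0_in e1_in by (auto simp: diag_char_def)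

lemma star_closed: "f \<in> X \<rightarrow>\<^sub>E X \<Longrightarrow> \<zeta> \<in> Y \<Longrightarrow> star f \<zeta> \<in> Y"
  using star_in by blast

text \<open>Taking both functions equal in \<open>star_diag\<close> settles the constant
  \<open>e1\<close>. The constant \<open>a\<close> is itself composed with the constant
  \<open>e1\<close>, so its value at \<zeta> is its value at the standard point
  \<open>e1\<close>.\<close>

lemma star_const:
  assumes a: "a \<in> X" and \<zeta>: "\<zeta> \<in> Y"
  shows "star (\<lambda>x\<in>X. a) \<zeta> = a"
proof -
  have c: "(\<lambda>x\<in>X. b) \<in> X \<rightarrow>\<^sub>E X" if "b \<in> X" for b
    using that by auto
  have "star (\<lambda>x\<in>X. diag_char e0 e1 ((\<lambda>x\<in>X. a) x) ((\<lambda>x\<in>X. a) x)) \<zeta> = e1"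
    using star_diag[OF c[OF a] c[OF a] \<zeta>] by simp
  then have e1: "star (\<lambda>x\<in>X. e1) \<zeta> = e1"
    by (simp add: diag_char_def)
  have "compose X (\<lambda>x\<in>X. a) (\<lambda>x\<in>X. e1) = (\<lambda>x\<in>X. a)"
    using e1_in by (auto simp: compose_def intro!: restrict_ext)
  then have "star (\<lambda>x\<in>X. a) \<zeta> = star (\<lambda>x\<in>X. a) (star (\<lambda>x\<in>X. e1) \<zeta>)"
    using star_comp[OF c[OF e1_in] c[OF a] \<zeta>] by simp
  then show ?thesis
    using e1 star_extends[OF c[OF a] e1_in] e1_in by simp
qed

text \<open>The one-equation case of the key fact. By \<open>star_diag\<close>, hypothesis and
  conclusion say that the characteristic functions \<open>?c\<close> and \<open>?d\<close> extend to
  value \<open>e1\<close> at \<zeta>.\<close>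

lemma star_eq_mono:
  assumes f: "f \<in> X \<rightarrow>\<^sub>E X" and g: "g \<in> X \<rightarrow>\<^sub>E X" and h: "h \<in> X \<rightarrow>\<^sub>E X" and k: "k \<in> X \<rightarrow>\<^sub>E X"
    and \<zeta>: "\<zeta> \<in> Y" and eq: "star f \<zeta> = star g \<zeta>"
    and imp: "\<And>x. x \<in> X \<Longrightarrow> f x = g x \<Longrightarrow> h x = k x"
  shows "star h \<zeta> = star k \<zeta>"
proof -
  let ?c = "\<lambda>x\<in>X. diag_char e0 e1 (f x) (g x)"
  let ?d = "\<lambda>x\<in>X. diag_char e0 e1 (h x) (k x)"
  have c1: "star ?c \<zeta> = e1"
    using star_diag[OF f g \<zeta>] eq by simp
  have "\<exists>a\<in>X. f a = g a"
  proof (rule ccontr)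
    assume "\<not> (\<exists>a\<in>X. f a = g a)"
    then have "?c = (\<lambda>x\<in>X. e0)"
      by (auto simp: diag_char_def intro!: restrict_ext)
    then show False
      using c1 star_const[OF e0_in \<zeta>] e0_neq_e1 by simp
  qed
  then obtain a where a: "a \<in> X" "f a = g a"
    by blast
  \<comment> \<open>\<open>f = g\<close> and \<open>h = k\<close> cut \<open>X\<close> into at most three classes. The map \<open>r\<close> sends each class to one of its
    elements (so \<open>X\<close> may have only two elements); then \<open>*r(\<zeta>) = a\<close> and \<open>*h(\<zeta>) = *k(\<zeta>)\<close> is decided at \<open>a\<close>.\<close>
  let ?same = "\<lambda>x y. y \<in> X \<and> (f y = g y \<longleftrightarrow> f x = g x) \<and> (h y = k y \<longleftrightarrow> h x = k x)"
  define r where "r = (\<lambda>x\<in>X. if f x = g x then a else SOME y. ?same x y)"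
  \<comment> \<open>On the class \<open>f = g\<close>, \<open>imp\<close> gives \<open>h = k\<close>
    at both \<open>x\<close> and \<open>a\<close>, so \<open>a\<close> may stand for the whole
    class.\<close>
  have r: "?same x (r x)" if "x \<in> X" for x
  proof (cases "f x = g x")
    case True
    then show ?thesis using that a imp by (simp add: r_def)
  next
    case False
    have "?same x (SOME y. ?same x y)"
      by (rule someI[of _ x]) (use that in simp)
    then show ?thesis using that False unfolding r_def by simp
  qed
  have rX: "r \<in> X \<rightarrow>\<^sub>E X"
    using r by (auto simp: r_def)
  have ca: "(\<lambda>x\<in>X. a) \<in> X \<rightarrow>\<^sub>E X"
    using a by auto
  \<comment> \<open>Since \<open>r\<close> respects whether \<open>f = g\<close>, \<open>?c\<close>
    is also the characteristic function of \<open>r = a\<close>, and \<open>star_diag\<close> turns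
    its value \<open>e1\<close> into \<open>star r \<zeta> = a\<close>.\<close>
  have "r x = a \<longleftrightarrow> f x = g x" if "x \<in> X" for x
    using r[OF that] a that by (auto simp: r_def)
  then have "(\<lambda>x\<in>X. diag_char e0 e1 (r x) ((\<lambda>x\<in>X. a) x)) = ?c"
    by (auto simp: diag_char_def intro!: restrict_ext)
  then have ra: "star r \<zeta> = a"
    using star_diag[OF rX ca \<zeta>] c1 star_const[OF a(1) \<zeta>] e0_neq_e1 by (auto split: if_splits)
  \<comment> \<open>\<open>r\<close> also respects whether \<open>h = k\<close>, so
    \<open>?d\<close> factors through it.\<close>
  have "compose X ?d r = ?d"
    using r by (auto simp: compose_def diag_char_def intro!: restrict_ext)
  then have "star ?d \<zeta> = star ?d a"
    using star_comp[OF rX diag_in \<zeta>, of h k] ra by simp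
  also have "\<dots> = e1"
    using star_extends[OF diag_in a(1), of h k] a imp by (simp add: diag_char_def)
  finally show ?thesis
    using star_diag[OF h k \<zeta>] e0_neq_e1 by (auto split: if_splits)
qed

lemma star_eq_mono_finite:
  fixes n :: nat
  assumes "\<And>i. i < n \<Longrightarrow> f i \<in> X \<rightarrow>\<^sub>E X" and "\<And>i. i < n \<Longrightarrow> g i \<in> X \<rightarrow>\<^sub>E X"
    and "h \<in> X \<rightarrow>\<^sub>E X" and "k \<in> X \<rightarrow>\<^sub>E X" and "\<zeta> \<in> Y"
    and "\<And>i. i < n \<Longrightarrow> star (f i) \<zeta> = star (g i) \<zeta>"
    and "\<And>x. x \<in> X \<Longrightarrow> (\<And>i. i < n \<Longrightarrow> f i x = g i x) \<Longrightarrow> h x = k x"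
  shows "star h \<zeta> = star k \<zeta>"
  using assms
proof (induction n arbitrary: h)
  case 0
  then have "h = k"
    by (intro PiE_ext[of h X _ k]) auto
  then show ?case by simp
next
  case (Suc n)
  \<comment> \<open>\<open>h'\<close> interpolates between \<open>h\<close> and \<open>k\<close>:
    the last equation alone gives \<open>h = h'\<close>, and the first \<open>n\<close> give
    \<open>h' = k\<close>. Hence \<open>h\<close> must vary in the induction.\<close>
  define h' where "h' = (\<lambda>x\<in>X. if f n x = g n x then h x else k x)"
  have h': "h' \<in> X \<rightarrow>\<^sub>E X"
    using Suc.prems(3,4) by (auto simp: h'_def)
  have "star h \<zeta> = star h' \<zeta>"
    by (rule star_eq_mono[of "f n" "g n"]) (use Suc.prems h' in \<open>auto simp: h'_def\<close>)
  also have "star h' \<zeta> = star k \<zeta>"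
  proof (rule Suc.IH)
    fix x assume x: "x \<in> X" "\<And>i. i < n \<Longrightarrow> f i x = g i x"
    show "h' x = k x"
      using Suc.prems(7)[OF x(1)] x less_Suc_eq by (auto simp: h'_def)
  qed (use Suc.prems h' in auto)
  finally show ?case .
qed

end

section \<open>Representing tuples over a single point\<close>

context directed_functional_extension
begin

text \<open>Directedness puts the point for the first \<open>n\<close> coordinates and the new
  coordinate over a common \<rho>; the old functions are precomposed with \<open>p\<close>.\<close>

lemma represents_exists:
  assumes "\<And>i. i < n \<Longrightarrow> \<xi> i \<in> Y"
  shows "\<exists>f \<zeta>. represents X Y star n f \<zeta> \<xi>"
  using assms
proof (induction n)
  case 0
  then show ?case
    using e0_in subset by (auto simp: represents_def)
next
  case (Suc n)
  then obtain f \<zeta> where f: "represents X Y star n f \<zeta> \<xi>"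
    by force
  then obtain p q \<rho> where p: "p \<in> X \<rightarrow>\<^sub>E X" and q: "q \<in> X \<rightarrow>\<^sub>E X" and \<rho>: "\<rho> \<in> Y"
    and eq: "star p \<rho> = \<zeta>" "star q \<rho> = \<xi> n"
    using directed[of \<zeta> "\<xi> n"] Suc.prems by (auto simp: represents_def)
  let ?f = "\<lambda>i. if i < n then compose X (f i) p else q"
  have "star (?f i) \<rho> = \<xi> i" if "i < Suc n" for i
  proof (cases "i < n")
    case True
    then show ?thesis
      using f star_comp[OF p _ \<rho>, of "f i"] eq by (auto simp: represents_def Pi_def)
  next
    case False
    then show ?thesis
      using that eq by (simp add: less_Suc_eq)
  qed
  moreover have "?f i \<in> X \<rightarrow>\<^sub>E X" for i
    using f p q compose_in[OF p, of "f i"] by (auto simp: represents_def Pi_def)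
  ultimately have "represents X Y star (Suc n) ?f \<rho> \<xi>"
    using \<rho> unfolding represents_def by blast
  then show ?case by blast
qed

lemma represents_unique_value:
  assumes \<phi>: "\<phi> \<in> nary n X"
    and f: "represents X Y star n f \<zeta> \<xi>" and g: "represents X Y star n g \<eta> \<xi>"
  shows "star (tuple_comp X n \<phi> f) \<zeta> = star (tuple_comp X n \<phi> g) \<eta>"
proof -
  obtain p q \<rho> where p: "p \<in> X \<rightarrow>\<^sub>E X" and q: "q \<in> X \<rightarrow>\<^sub>E X" and \<rho>: "\<rho> \<in> Y"
    and eq: "star p \<rho> = \<zeta>" "star q \<rho> = \<eta>"
    using directed[of \<zeta> \<eta>] f g by (auto simp: represents_def)
  have fi: "f i \<in> X \<rightarrow>\<^sub>E X" and gi: "g i \<in> X \<rightarrow>\<^sub>E X"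
    and fg: "star (f i) \<zeta> = star (g i) \<eta>" if "i < n" for i
    using f g that by (auto simp: represents_def Pi_def)
  note fp = compose_in[OF p fi] and gq = compose_in[OF q gi]
  have "star (tuple_comp X n \<phi> f) \<zeta> = star (tuple_comp X n \<phi> (\<lambda>i. compose X (f i) p)) \<rho>"
    using star_comp[OF p tuple_comp_in[OF \<phi> fi] \<rho>] eq by (simp add: compose_tuple_comp[OF p])
  \<comment> \<open>Where the pulled-back functions agree for all \<open>i < n\<close>, \<phi>
    receives the same tuple.\<close>
  also have "\<dots> = star (tuple_comp X n \<phi> (\<lambda>i. compose X (g i) q)) \<rho>"
  proof (rule star_eq_mono_finite[OF fp gq tuple_comp_in[OF \<phi> fp] tuple_comp_in[OF \<phi> gq] \<rho>])
    fix i assume "i < n"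
    then show "star (compose X (f i) p) \<rho> = star (compose X (g i) q) \<rho>"
      using star_comp[OF p fi \<rho>] star_comp[OF q gi \<rho>] fg eq by metis
  next
    fix x assume "x \<in> X" and e: "\<And>i. i < n \<Longrightarrow> compose X (f i) p x = compose X (g i) q x"
    have "(\<lambda>i\<in>{..<n}. compose X (f i) p x) = (\<lambda>i\<in>{..<n}. compose X (g i) q x)"
      using e by (intro restrict_ext) simp
    then show "tuple_comp X n \<phi> (\<lambda>i. compose X (f i) p) x =
        tuple_comp X n \<phi> (\<lambda>i. compose X (g i) q) x"
      using \<open>x \<in> X\<close> by (simp only: tuple_comp_apply)
  qed
  also have "\<dots> = star (tuple_comp X n \<phi> g) \<eta>"
    using star_comp[OF q tuple_comp_in[OF \<phi> gi] \<rho>] eq by (simp add: compose_tuple_comp[OF q])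
  finally show ?thesis .
qed

text \<open>Preservation of compositions is applied with \<open>m = 1\<close> to the
  \<open>f i\<close> read as functions of 1-tuples, and evaluated at the 1-tuple of \<zeta>: the
  inner values are then the coordinates of \<xi>.\<close>

lemma assignment_formula:
  assumes S: "nary_extension_assignment X Y star S" and n: "n \<ge> 1" and \<phi>: "\<phi> \<in> nary n X"
    and \<xi>: "\<xi> \<in> tuples n Y" and f: "represents X Y star n f \<zeta> \<xi>"
  shows "S n \<phi> \<xi> = star (tuple_comp X n \<phi> f) \<zeta>"
proof -
  have fi: "f i \<in> X \<rightarrow>\<^sub>E X" if "i < n" for i
    using f that by (auto simp: represents_def)
  have \<zeta>: "\<zeta> \<in> Y"
    using f by (simp add: represents_def)
  let ?\<psi> = "\<lambda>i. as_unary X (f i)" and ?z = "\<lambda>i\<in>{..<1::nat}. \<zeta>"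
  have z: "?z \<in> tuples 1 Y"
    using \<zeta> unfolding tuples_def by auto
  have un: "S 1 (as_unary X h) = as_unary Y (star h)" if "h \<in> X \<rightarrow>\<^sub>E X" for h
    using S that unfolding nary_extension_assignment_def by blast
  have \<psi>: "?\<psi> \<in> {..<n} \<rightarrow> nary 1 X"
    using as_unary_in[OF fi] by auto
  have comp: "tuple_comp (tuples 1 Y) n (S n \<phi>) (\<lambda>i. S 1 (?\<psi> i)) =
      S 1 (tuple_comp (tuples 1 X) n \<phi> ?\<psi>)"
    using S[unfolded nary_extension_assignment_def, THEN conjunct2, THEN conjunct2,
        THEN conjunct2, rule_format, OF order_refl n \<phi> \<psi>] .
  \<comment> \<open>The composite is again a unary function in disguise, so agreement with
    \<open>star\<close> evaluates the right-hand side.\<close>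
  have "tuple_comp (tuples 1 X) n \<phi> ?\<psi> = as_unary X (tuple_comp X n \<phi> f)"
    by (auto simp: tuple_comp_def as_unary_def tuples_def intro!: ext arg_cong[where f = \<phi>])
  then have r: "S 1 (tuple_comp (tuples 1 X) n \<phi> ?\<psi>) ?z = star (tuple_comp X n \<phi> f) \<zeta>"
    using un[OF tuple_comp_in[OF \<phi> fi]] z by (simp add: as_unary_def)
  have "(\<lambda>i\<in>{..<n}. S 1 (?\<psi> i) ?z) = (\<lambda>i\<in>{..<n}. \<xi> i)"
    using f un[OF fi] z by (intro restrict_ext) (simp add: as_unary_def represents_def)
  also have "\<dots> = \<xi>"
    using \<xi> unfolding tuples_def by (simp add: PiE_restrict)
  finally have "tuple_comp (tuples 1 Y) n (S n \<phi>) (\<lambda>i. S 1 (?\<psi> i)) ?z = S n \<phi> \<xi>"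
    by (simp only: tuple_comp_apply[OF z])
  then show ?thesis
    using comp r by simp
qed

section \<open>Construction and uniqueness of the assignment\<close>

lemma tuple_represents: "\<xi> \<in> tuples n Y \<Longrightarrow> \<exists>f \<zeta>. represents X Y star n f \<zeta> \<xi>"
  by (rule represents_exists) (auto simp: tuples_def)

text \<open>The choice is harmless by \<open>represents_unique_value\<close>. The three restrictions
  supply the extensionality required of an assignment.\<close>

definition nary_star :: "nat \<Rightarrow> ((nat \<Rightarrow> 'a) \<Rightarrow> 'a) \<Rightarrow> (nat \<Rightarrow> 'a) \<Rightarrow> 'a" where
  "nary_star = (\<lambda>n\<in>{1..}. \<lambda>\<phi>\<in>nary n X. \<lambda>\<xi>\<in>tuples n Y.
    SOME y. \<exists>f \<zeta>. represents X Y star n f \<zeta> \<xi> \<and> y = star (tuple_comp X n \<phi> f) \<zeta>)"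

lemma nary_star_eq:
  assumes "n \<ge> 1" and \<phi>: "\<phi> \<in> nary n X" and \<xi>: "\<xi> \<in> tuples n Y"
    and f: "represents X Y star n f \<zeta> \<xi>"
  shows "nary_star n \<phi> \<xi> = star (tuple_comp X n \<phi> f) \<zeta>"
proof -
  have "(SOME y. \<exists>f \<zeta>. represents X Y star n f \<zeta> \<xi> \<and> y = star (tuple_comp X n \<phi> f) \<zeta>) =
      star (tuple_comp X n \<phi> f) \<zeta>"
    using f represents_unique_value[OF \<phi> _ f] by (intro some_equality) blast+
  then show ?thesis
    using assms by (simp add: nary_star_def)
qed

lemma nary_star_in: "nary_star \<in> (\<Pi>\<^sub>E n\<in>{1..}. nary n X \<rightarrow>\<^sub>E nary n Y)"
proof -
  have v: "nary_star n \<phi> \<xi> \<in> Y"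
    if "n \<ge> 1" and \<phi>: "\<phi> \<in> nary n X" and \<xi>: "\<xi> \<in> tuples n Y" for n \<phi> \<xi>
  proof -
    obtain f \<zeta> where f: "represents X Y star n f \<zeta> \<xi>"
      using tuple_represents[OF \<xi>] by blast
    then have "star (tuple_comp X n \<phi> f) \<zeta> \<in> Y"
      by (intro star_closed tuple_comp_in[OF \<phi>]) (auto simp: represents_def)
    then show ?thesis
      using nary_star_eq[OF that f] by simp
  qed
  have "nary_star n \<phi> \<in> nary n Y" if "n \<ge> 1" "\<phi> \<in> nary n X" for n \<phi>
    using v[OF that] that unfolding nary_def[of n Y] by (intro PiE_I) (auto simp: nary_star_def)
  then show ?thesis
    by (intro PiE_I) (auto simp: nary_star_def)
qed

lemma nary_star_assignment: "nary_extension_assignment X Y star nary_star"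
  unfolding nary_extension_assignment_def
proof (intro conjI allI impI ballI)
  show "nary_star \<in> (\<Pi>\<^sub>E n\<in>{1..}. nary n X \<rightarrow>\<^sub>E nary n Y)"
    by (rule nary_star_in)
next
  fix n :: nat and \<phi> x
  assume n: "1 \<le> n" and \<phi>: "\<phi> \<in> nary n X" and x: "x \<in> tuples n X"
  have xi: "x i \<in> X" if "i < n" for i
    using x that by (auto simp: tuples_def)
  have e0: "e0 \<in> Y"
    using e0_in subset by blast
  have xY: "x \<in> tuples n Y"
    using x subset by (auto simp: tuples_def)
  \<comment> \<open>Constants represent a standard tuple over any point; \<open>e0\<close> lies in
    \<open>X\<close>, so \<open>star_extends\<close> evaluates the formula there.\<close>
  let ?f = "\<lambda>i. \<lambda>y\<in>X. x i"
  have f: "represents X Y star n ?f e0 x"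
    using xi star_const[OF xi e0] e0 by (auto simp: represents_def)
  have "tuple_comp X n \<phi> ?f e0 = \<phi> (\<lambda>i\<in>{..<n}. x i)"
    using e0_in by (simp add: tuple_comp_apply)
  also have "(\<lambda>i\<in>{..<n}. x i) = x"
    using x unfolding tuples_def by (rule PiE_restrict)
  finally have "tuple_comp X n \<phi> ?f e0 = \<phi> x" .
  moreover have "tuple_comp X n \<phi> ?f \<in> X \<rightarrow>\<^sub>E X"
    using xi by (intro tuple_comp_in[OF \<phi>]) auto
  ultimately show "nary_star n \<phi> x = \<phi> x"
    using nary_star_eq[OF n \<phi> xY f] star_extends e0_in by simp
next
  fix h assume h: "h \<in> X \<rightarrow>\<^sub>E X"
  have u: "as_unary X h \<in> nary 1 X"
    by (rule as_unary_in[OF h])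
  show "nary_star 1 (as_unary X h) = as_unary Y (star h)"
  proof (rule PiE_ext)
    show "nary_star 1 (as_unary X h) \<in> tuples 1 Y \<rightarrow>\<^sub>E Y"
      using PiE_mem[OF PiE_mem[OF nary_star_in] u] unfolding nary_def[of 1 Y] by simp
    show "as_unary Y (star h) \<in> tuples 1 Y \<rightarrow>\<^sub>E Y"
      using as_unary_in[OF star_in[OF h]] unfolding nary_def .
    fix \<xi> assume \<xi>: "\<xi> \<in> tuples 1 Y"
    then obtain f \<zeta> where f: "represents X Y star 1 f \<zeta> \<xi>"
      using tuple_represents by blast
    then have f0: "f 0 \<in> X \<rightarrow>\<^sub>E X" and \<zeta>: "\<zeta> \<in> Y" and s: "star (f 0) \<zeta> = \<xi> 0"
      by (auto simp: represents_def)
    \<comment> \<open>With one coordinate the formula reduces to \<open>star_comp\<close>.\<close>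
    have "tuple_comp X 1 (as_unary X h) f = compose X h (f 0)"
      using f0 by (auto simp: tuple_comp_def as_unary_def compose_def tuples_def intro!: ext)
    then show "nary_star 1 (as_unary X h) \<xi> = as_unary Y (star h) \<xi>"
      using nary_star_eq[OF _ u \<xi> f] star_comp[OF f0 h \<zeta>] s \<xi> by (simp add: as_unary_def)
  qed
next
  fix m n :: nat and \<phi> \<psi>
  assume m: "1 \<le> m" and n: "1 \<le> n" and \<phi>: "\<phi> \<in> nary n X" and \<psi>: "\<psi> \<in> {..<n} \<rightarrow> nary m X"
  have \<psi>i: "\<psi> i \<in> nary m X" if "i < n" for i
    using \<psi> that by auto
  have c: "tuple_comp (tuples m X) n \<phi> \<psi> \<in> nary m X"
    using tuple_comp_in[OF \<phi>] \<psi>i unfolding nary_def[of m X] by blast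
  have s: "nary_star k \<alpha> \<in> nary k Y" if "k \<ge> 1" "\<alpha> \<in> nary k X" for k \<alpha>
    using PiE_mem[OF PiE_mem[OF nary_star_in] that(2)] that(1) by simp
  show "tuple_comp (tuples m Y) n (nary_star n \<phi>) (\<lambda>i. nary_star m (\<psi> i)) =
      nary_star m (tuple_comp (tuples m X) n \<phi> \<psi>)"
  proof (rule PiE_ext)
    show "tuple_comp (tuples m Y) n (nary_star n \<phi>) (\<lambda>i. nary_star m (\<psi> i)) \<in> tuples m Y \<rightarrow>\<^sub>E Y"
      using s[OF m \<psi>i] by (intro tuple_comp_in[OF s[OF n \<phi>]]) (simp add: nary_def)
    show "nary_star m (tuple_comp (tuples m X) n \<phi> \<psi>) \<in> tuples m Y \<rightarrow>\<^sub>E Y"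
      using s[OF m c] unfolding nary_def .
    fix \<xi> assume \<xi>: "\<xi> \<in> tuples m Y"
    then obtain f \<zeta> where f: "represents X Y star m f \<zeta> \<xi>"
      using tuple_represents by blast
    have fi: "f i \<in> X \<rightarrow>\<^sub>E X" if "i < m" for i
      using f that by (auto simp: represents_def)
    have \<zeta>: "\<zeta> \<in> Y"
      using f by (simp add: represents_def)
    \<comment> \<open>The representation of \<xi> induces one of the tuple of inner values over the
      same \<zeta>. Both sides thus become extensions of unary functions at \<zeta>, equal by
      associativity of substitution.\<close>
    let ?g = "\<lambda>i. tuple_comp X m (\<psi> i) f" and ?\<eta> = "\<lambda>i\<in>{..<n}. nary_star m (\<psi> i) \<xi>"
    have g: "?g i \<in> X \<rightarrow>\<^sub>E X" if "i < n" for i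
      by (rule tuple_comp_in[OF \<psi>i[OF that] fi])
    have \<eta>i: "star (?g i) \<zeta> = nary_star m (\<psi> i) \<xi>" if "i < n" for i
      using nary_star_eq[OF m \<psi>i[OF that] \<xi> f] by simp
    have r: "represents X Y star n ?g \<zeta> ?\<eta>"
      using g \<eta>i \<zeta> by (auto simp: represents_def)
    have "?\<eta> \<in> tuples n Y"
      using star_closed[OF g \<zeta>] \<eta>i by (auto simp: tuples_def)
    then have "nary_star n \<phi> ?\<eta> = star (tuple_comp X n \<phi> ?g) \<zeta>"
      by (rule nary_star_eq[OF n \<phi> _ r])
    also have "tuple_comp X n \<phi> ?g = tuple_comp X m (tuple_comp (tuples m X) n \<phi> \<psi>) f"
    proof
      fix x
      have "(\<lambda>i\<in>{..<m}. f i x) \<in> tuples m X" if "x \<in> X"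
        using PiE_mem[OF fi that] unfolding tuples_def by auto
      then show "tuple_comp X n \<phi> ?g x = tuple_comp X m (tuple_comp (tuples m X) n \<phi> \<psi>) f x"
        by (cases "x \<in> X") (simp_all add: tuple_comp_def)
    qed
    finally show "tuple_comp (tuples m Y) n (nary_star n \<phi>) (\<lambda>i. nary_star m (\<psi> i)) \<xi> =
        nary_star m (tuple_comp (tuples m X) n \<phi> \<psi>) \<xi>"
      by (simp only: tuple_comp_apply[OF \<xi>] nary_star_eq[OF m c \<xi> f])
  qed
qed

text \<open>Extensionality in arity, function and tuple leaves only values that the formula fixes
  independently of the assignment.\<close>

lemma assignment_unique:
  assumes S: "nary_extension_assignment X Y star S" and T: "nary_extension_assignment X Y star T"
  shows "S = T"
proof (rule PiE_ext)
  show SP: "S \<in> (\<Pi>\<^sub>E n\<in>{1..}. nary n X \<rightarrow>\<^sub>E nary n Y)"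
    and TP: "T \<in> (\<Pi>\<^sub>E n\<in>{1..}. nary n X \<rightarrow>\<^sub>E nary n Y)"
    using S T by (auto simp: nary_extension_assignment_def)
  fix n :: nat assume n: "n \<in> {1..}"
  show "S n = T n"
  proof (rule PiE_ext[OF PiE_mem[OF SP n] PiE_mem[OF TP n]])
    fix \<phi> assume \<phi>: "\<phi> \<in> nary n X"
    show "S n \<phi> = T n \<phi>"
    proof (rule PiE_ext)
      show "S n \<phi> \<in> tuples n Y \<rightarrow>\<^sub>E Y" "T n \<phi> \<in> tuples n Y \<rightarrow>\<^sub>E Y"
        using PiE_mem[OF PiE_mem[OF SP n] \<phi>] PiE_mem[OF PiE_mem[OF TP n] \<phi>]
        unfolding nary_def by auto
      fix \<xi> assume \<xi>: "\<xi> \<in> tuples n Y"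
      then obtain f \<zeta> where "represents X Y star n f \<zeta> \<xi>"
        using tuple_represents by blast
      then show "S n \<phi> \<xi> = T n \<phi> \<xi>"
        using assignment_formula[OF S _ \<phi> \<xi>] assignment_formula[OF T _ \<phi> \<xi>] n by simp
    qed
  qed
qed

end

theorem theorem3p3:
  fixes X Y :: "'a set" and e0 e1 :: 'a and star :: "('a \<Rightarrow> 'a) \<Rightarrow> 'a \<Rightarrow> 'a"
  assumes "directed_functional_extension X Y e0 e1 star"
  shows "(\<exists>!S. nary_extension_assignment X Y star S) \<and>
    (\<forall>n\<ge>1. \<forall>\<xi>\<in>tuples n Y. \<exists>f \<zeta>. represents X Y star n f \<zeta> \<xi>) \<and>
    (\<forall>n\<ge>1. \<forall>\<phi>\<in>nary n X. \<forall>\<xi>\<in>tuples n Y. \<forall>f \<zeta> g \<eta>.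
      represents X Y star n f \<zeta> \<xi> \<longrightarrow> represents X Y star n g \<eta> \<xi> \<longrightarrow>
      star (tuple_comp X n \<phi> f) \<zeta> = star (tuple_comp X n \<phi> g) \<eta>) \<and>
    (\<forall>S. nary_extension_assignment X Y star S \<longrightarrow>
      (\<forall>n\<ge>1. \<forall>\<phi>\<in>nary n X. \<forall>\<xi>\<in>tuples n Y. \<forall>f \<zeta>.
        represents X Y star n f \<zeta> \<xi> \<longrightarrow>
        S n \<phi> \<xi> = star (tuple_comp X n \<phi> f) \<zeta>))"
proof -
  interpret directed_functional_extension X Y e0 e1 star by fact
  have "\<exists>!S. nary_extension_assignment X Y star S"
    using nary_star_assignment assignment_unique by blast
  then show ?thesis
    using tuple_represents represents_unique_value assignment_formula by blast
qed

end
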